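(* Let $m,n,M,N$ be positive integers with $m\le M$, $n\le N$, let $p_{ij}\in\mathbb{R}$ for $i\in\{1,\ldots,M\}$, $j\in\{1,\ldots,N\}$, and let $I_1=\{y_1,\ldots,y_M\}$, $J_1=\{z_1,\ldots,z_N\}$ be sets of real numbers with $y_1<\cdots<y_M$ and $z_1<\cdots<z_N$. Then the inequality $$\sum_{i=1}^M\sum_{j=1}^N p_{ij}f(y_i,z_j)\ge 0$$ holds for all $(m,n)$-$\nabla$-convex discrete functions $f:I_1\times J_1\to\mathbb{R}$ if and only if all of the following hold: $$\sum_{s=1}^{M-t}\sum_{r=1}^{N-k}p_{sr}(z_N-z_r)^{\{k\}}(y_M-y_s)^{\{t\}}=0,\quad k\in\{0,\ldots,n-1\},\ t\in\{0,\ldots,m-1\};$$ $$\sum_{s=1}^{t}\sum_{r=1}^{N-k}p_{sr}(z_N-z_r)^{\{k\}}(y_{t+m-1}-y_s)^{\{m-1\}}=0,\quad k\in\{0,\ldots,n-1\},\ t\in\{1,\ldots,M-m\};$$ $$\sum_{s=1}^{M-t}\sum_{r=1}^{k}p_{sr}(z_{k+n-1}-z_r)^{\{n-1\}}(y_M-y_s)^{\{t\}}=0,\quad k\in\{1,\ldots,N-n\},\ t\in\{0,\ldots,m-1\};$$ $$\sum_{s=1}^{t}\sum_{r=1}^{k}p_{sr}(y_{t+m-1}-y_s)^{\{m-1\}}(z_{k+n-1}-z_r)^{\{n-1\}}\ge 0,\quad k\in\{1,\ldots,N-n\},\ t\in\{1,\ldots,M-m\}.$$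
   Context: Notation: $(y_k-y_i)^{\{0\}}=1$ and $(y_k-y_i)^{\{l+1\}}=(y_k-y_i)(y_{k-1}-y_i)\cdots(y_{k-l}-y_i)$ for $l\ge0$; similarly for the $z$'s. For a function $g$ of one variable and distinct points, $[x_j;g]=g(x_j)$ and $[x_i,\ldots,x_{i+l};g]=\dfrac{[x_{i+1},\ldots,x_{i+l};g]-[x_i,\ldots,x_{i+l-1};g]}{x_{i+l}-x_i}$. A discrete function $f:I_1\times J_1\to\mathbb{R}$ is $(m,n)$-$\nabla$-convex if $(-1)^{m+n}[u_0,\ldots,u_m;[v_0,\ldots,v_n;f]]\ge 0$ for all choices of $m+1$ distinct points $u_0,\ldots,u_m\in I_1$ and $n+1$ distinct points $v_0,\ldots,v_n\in J_1$ (divided difference in the second variable with the first fixed, then in the first variable). *)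

theory Defs
  imports Complex_Main
begin

text \<open>\<open>divided_difference x g i l\<close> is \<open>[x i, \<dots>, x (i + l); g]\<close>.\<close>

fun divided_difference :: "(nat \<Rightarrow> real) \<Rightarrow> (real \<Rightarrow> real) \<Rightarrow> nat \<Rightarrow> nat \<Rightarrow> real" where
  "divided_difference x g i 0 = g (x i)"
| "divided_difference x g i (Suc l) =
     (divided_difference x g (Suc i) l - divided_difference x g i l) / (x (i + Suc l) - x i)"

text \<open>A discrete function \<open>I \<times> J \<rightarrow> \<real>\<close> is represented by a total function; only its values
  on \<open>I \<times> J\<close> enter the definition.\<close>

definition nabla_convex ::
  "nat \<Rightarrow> nat \<Rightarrow> real set \<Rightarrow> real set \<Rightarrow> (real \<Rightarrow> real \<Rightarrow> real) \<Rightarrow> bool" where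
  "nabla_convex m n I J f \<longleftrightarrow>
     (\<forall>u v. inj_on u {0..m} \<and> u ` {0..m} \<subseteq> I \<and> inj_on v {0..n} \<and> v ` {0..n} \<subseteq> J \<longrightarrow>
        (-1) ^ (m + n) *
          divided_difference u (\<lambda>x. divided_difference v (\<lambda>w. f x w) 0 n) 0 m \<ge> 0)"

text \<open>\<open>brace_power y k i l\<close> is \<open>(y\<^sub>k - y\<^sub>i)\<^bsup>{l}\<^esup> = (y\<^sub>k - y\<^sub>i) (y\<^sub>k\<^sub>-\<^sub>1 - y\<^sub>i) \<dots> (y\<^sub>k\<^sub>-\<^sub>l\<^sub>+\<^sub>1 - y\<^sub>i)\<close>,
  a product of \<open>l\<close> factors. The subtraction \<open>k - q\<close> is on \<^typ>\<open>nat\<close>, so the definition is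
  meaningful for \<open>l \<le> k\<close> only (with points indexed from 1).\<close>

definition brace_power :: "(nat \<Rightarrow> real) \<Rightarrow> nat \<Rightarrow> nat \<Rightarrow> nat \<Rightarrow> real" where
  "brace_power y k i l = (\<Prod>q<l. y (k - q) - y i)"

end

theory Submission
  imports Defs
begin

text \<open>The braces in the four families of conditions are the values on the grid of a basis of
  one-variable functions: polynomials of degree below \<open>m\<close>, and truncated polynomials
  \<open>\<Prod>(y - x)\<close> supported to the left of a grid point. Divided differences of order \<open>m\<close> annihilate
  the former, have sign \<open>(-1)\<^sup>m\<close> on the latter, and those over \<open>m + 1\<close> consecutive points are dual to
  the latter. Hence in the expansion of a \<open>\<nabla>\<close>-convex function in tensor products of basis elements
  the coefficients of the products of two truncated polynomials are nonnegative and the others are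
  arbitrary, while conversely such products, and all other products with either sign, are
  \<open>\<nabla>\<close>-convex.\<close>

section \<open>Divided differences over finite sets of nodes\<close>

text \<open>The Lagrange form of the divided difference. Taking a set of nodes builds in the
  symmetry in the nodes, so no enumeration has to be carried along.\<close>

definition lagrange_dd :: "real set \<Rightarrow> (real \<Rightarrow> real) \<Rightarrow> real" where
  "lagrange_dd S g = (\<Sum>s\<in>S. g s / (\<Prod>t\<in>S - {s}. s - t))"

lemma lagrange_dd_cong:
  "(\<And>s. s \<in> S \<Longrightarrow> g s = h s) \<Longrightarrow> lagrange_dd S g = lagrange_dd S h"
  by (simp add: lagrange_dd_def)

lemma lagrange_dd_zero [simp]: "lagrange_dd S (\<lambda>_. 0) = 0"
  by (simp add: lagrange_dd_def)

lemma lagrange_dd_add: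
  "lagrange_dd S (\<lambda>x. g x + h x) = lagrange_dd S g + lagrange_dd S h"
  by (simp add: lagrange_dd_def add_divide_distrib sum.distrib)

lemma lagrange_dd_cmult: "lagrange_dd S (\<lambda>x. c * g x) = c * lagrange_dd S g"
  by (simp add: lagrange_dd_def sum_distrib_left)

lemma lagrange_dd_multc: "lagrange_dd S (\<lambda>x. g x * c) = lagrange_dd S g * c"
  using lagrange_dd_cmult[of S c g] by (simp add: mult.commute)

lemma lagrange_dd_sum:
  "lagrange_dd S (\<lambda>x. \<Sum>a\<in>A. g a x) = (\<Sum>a\<in>A. lagrange_dd S (g a))"
  by (induction A rule: infinite_finite_induct) (simp_all add: lagrange_dd_add)

lemma lagrange_dd_insert:
  assumes "finite T" "a \<notin> T"
  shows "lagrange_dd (insert a T) g =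
    g a / (\<Prod>t\<in>T. a - t) + (\<Sum>s\<in>T. g s / ((s - a) * (\<Prod>t\<in>T - {s}. s - t)))"
proof -
  have "insert a T - {s} = insert a (T - {s})" if "s \<in> T" for s
    using that assms by auto
  then show ?thesis
    using assms by (simp add: lagrange_dd_def)
qed

text \<open>Termwise partial fractions:
  \<open>(a - b) / ((s - a) * (s - b)) = 1 / (s - a) - 1 / (s - b)\<close>. The terms at
  \<open>a\<close> and \<open>b\<close> lose the factor \<open>a - b\<close>, up to sign.\<close>

lemma lagrange_dd_recurrence:
  assumes "finite T" "a \<notin> T" "b \<notin> T" "a \<noteq> b"
  shows "(a - b) * lagrange_dd (insert a (insert b T)) g =
    lagrange_dd (insert a T) g - lagrange_dd (insert b T) g"
proof -
  have partial_fractions: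
    "(a - b) * (x / ((s - a) * ((s - b) * P))) = x / ((s - a) * P) - x / ((s - b) * P)"
    if "s \<noteq> a" "s \<noteq> b" for x s P :: real
    using that by (cases "P = 0") (simp_all add: divide_simps, simp add: algebra_simps)
  have "insert b T - {s} = insert b (T - {s})" if "s \<in> T" for s
    using that assms by auto
  then have "(\<Sum>s\<in>T. (a - b) * (g s / ((s - a) * (\<Prod>t\<in>insert b T - {s}. s - t)))) =
      (\<Sum>s\<in>T. (a - b) * (g s / ((s - a) * ((s - b) * (\<Prod>t\<in>T - {s}. s - t)))))"
    using assms by (intro sum.cong) auto
  also have "\<dots> = (\<Sum>s\<in>T. g s / ((s - a) * (\<Prod>t\<in>T - {s}. s - t)) -
      g s / ((s - b) * (\<Prod>t\<in>T - {s}. s - t)))"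
    using assms by (intro sum.cong refl partial_fractions) auto
  finally have interior: "(a - b) * (\<Sum>s\<in>T. g s / ((s - a) * (\<Prod>t\<in>insert b T - {s}. s - t))) =
      (\<Sum>s\<in>T. g s / ((s - a) * (\<Prod>t\<in>T - {s}. s - t))) -
      (\<Sum>s\<in>T. g s / ((s - b) * (\<Prod>t\<in>T - {s}. s - t)))"
    by (simp only: sum_distrib_left sum_subtractf)
  have at_b: "(a - b) * (g b / ((b - a) * P)) = - (g b / P)" for P
  proof -
    have "(a - b) * (g b / ((b - a) * P)) = ((a - b) / (b - a)) * (g b / P)"
      by simp
    also have "(a - b) / (b - a) = -1"
      using assms(4) by (simp add: divide_simps)
    finally show ?thesis by simp
  qed
  have *: "lagrange_dd (insert a (insert b T)) g =
    g a / ((a - b) * (\<Prod>t\<in>T. a - t)) + (g b / ((b - a) * (\<Prod>t\<in>T. b - t)) +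
    (\<Sum>s\<in>T. g s / ((s - a) * (\<Prod>t\<in>insert b T - {s}. s - t))))"
    using assms by (subst lagrange_dd_insert) auto
  show ?thesis
    unfolding * distrib_left interior at_b
    using assms by (simp add: lagrange_dd_insert)
qed

lemma divided_difference_eq_lagrange_dd:
  assumes "inj_on x {i..i + l}"
  shows "divided_difference x g i l = lagrange_dd (x ` {i..i + l}) g"
  using assms
proof (induction l arbitrary: i)
  case 0
  then show ?case by (simp add: lagrange_dd_def)
next
  case (Suc l)
  \<comment> \<open>The nodes common to both differences of order \<open>l\<close>; \<open>a\<close>
    and \<open>b\<close> are the node that each has in addition.\<close>
  define T where "T = x ` {Suc i..i + l}"
  define a where "a = x (i + Suc l)"
  define b where "b = x i"
  have idx: "{Suc i..Suc i + l} = insert (i + Suc l) {Suc i..i + l}"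
    "{i..i + l} = insert i {Suc i..i + l}"
    "{i..i + Suc l} = insert (i + Suc l) (insert i {Suc i..i + l})"
    by auto
  have "inj_on x {Suc i..Suc i + l}" "inj_on x {i..i + l}"
    by (auto intro!: inj_on_subset[OF Suc.prems])
  then have dd: "divided_difference x g (Suc i) l = lagrange_dd (insert a T) g"
    "divided_difference x g i l = lagrange_dd (insert b T) g"
    by (simp_all only: Suc.IH, simp_all only: idx T_def a_def b_def image_insert)
  have notin: "a \<notin> T" "b \<notin> T" "a \<noteq> b" "finite T"
    using Suc.prems unfolding T_def a_def b_def by (auto dest!: inj_onD)
  have "x ` {i..i + Suc l} = insert a (insert b T)"
    by (simp only: idx T_def a_def b_def image_insert)
  moreover have "divided_difference x g i (Suc l) =
      (lagrange_dd (insert a T) g - lagrange_dd (insert b T) g) / (a - b)"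
    by (simp only: divided_difference.simps dd a_def b_def)
  moreover have "(lagrange_dd (insert a T) g - lagrange_dd (insert b T) g) / (a - b) =
      lagrange_dd (insert a (insert b T)) g"
    using lagrange_dd_recurrence[of T a b g] notin by (simp add: divide_eq_eq mult.commute)
  ultimately show ?case by metis
qed

text \<open>The factor \<open>x - c\<close> removes the term at \<open>c\<close> and cancels against
  \<open>s - c\<close> in every other denominator.\<close>

lemma lagrange_dd_cancel_factor:
  assumes "finite S" "c \<in> S"
  shows "lagrange_dd S (\<lambda>x. (x - c) * h x) = lagrange_dd (S - {c}) h"
proof -
  have S: "S = insert c (S - {c})"
    using assms by auto
  have "lagrange_dd (insert c (S - {c})) (\<lambda>x. (x - c) * h x) = lagrange_dd (S - {c}) h"
    using assms by (subst lagrange_dd_insert) (auto simp: lagrange_dd_def intro!: sum.cong)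
  then show ?thesis
    using S by simp
qed

text \<open>Polynomials of degree \<open>t\<close> are annihilated by differences over at least
  \<open>t + 2\<close> nodes. Induction on the number of factors: for a node \<open>s\<close>, the
  last factor is \<open>(c t - s) - (x - s)\<close>; the first part is a constant, the second
  deletes the node \<open>s\<close>.\<close>

lemma lagrange_dd_linear_factors_eq_0:
  assumes "finite S" "t + 2 \<le> card S"
  shows "lagrange_dd S (\<lambda>x. \<Prod>q<t. c q - x) = 0"
  using assms
proof (induction t arbitrary: S)
  case 0
  then show ?case
  proof (induction "card S" arbitrary: S rule: less_induct)
    case less
    obtain a where a: "a \<in> S" using less.prems by fastforce
    have "card (S - {a}) \<ge> 1" using less.prems a by simp
    then have "S - {a} \<noteq> {}" by (metis card.empty not_one_le_zero)
    then obtain b where b: "b \<in> S - {a}" by blast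
    define T where "T = S - {a} - {b}"
    have S: "S = insert a (insert b T)" and T: "a \<notin> T" "b \<notin> T" "a \<noteq> b" "finite T"
      using a b less.prems unfolding T_def by auto
    \<comment> \<open>Both sides are 1 for a single node, and 0 by the induction hypothesis
      otherwise.\<close>
    have "lagrange_dd (insert a T) (\<lambda>x. 1) = lagrange_dd (insert b T) (\<lambda>x. 1)"
    proof (cases "T = {}")
      case True
      then show ?thesis by (simp add: lagrange_dd_def)
    next
      case False
      then have "card T \<ge> 1" using T by (simp add: Suc_le_eq card_gt_0_iff)
      then show ?thesis
        using less.hyps[of "insert a T"] less.hyps[of "insert b T"] T S by simp
    qed
    then show ?case
      using lagrange_dd_recurrence[of T a b "\<lambda>x. 1"] T S by simp
  qed
next
  case (Suc t)
  obtain s where s: "s \<in> S" using Suc.prems by fastforce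
  have "(\<lambda>x. \<Prod>q<Suc t. c q - x) =
      (\<lambda>x. (c t - s) * (\<Prod>q<t. c q - x) + (- 1) * ((x - s) * (\<Prod>q<t. c q - x)))"
    by (auto simp: algebra_simps)
  then have "lagrange_dd S (\<lambda>x. \<Prod>q<Suc t. c q - x) =
      (c t - s) * lagrange_dd S (\<lambda>x. \<Prod>q<t. c q - x)
      + (- 1) * lagrange_dd (S - {s}) (\<lambda>x. \<Prod>q<t. c q - x)"
    using Suc.prems s by (simp only: lagrange_dd_add lagrange_dd_cmult lagrange_dd_cancel_factor)
  then show ?case
    using Suc.IH[of S] Suc.IH[of "S - {s}"] Suc.prems s by simp
qed

section \<open>Convexity as a sign condition on sets of nodes, and reduction to consecutive
  nodes\<close>

text \<open>Each node set of the right size is the image of some injective enumeration, and the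
  Lagrange form does not depend on which one.\<close>

lemma nabla_convex_iff_lagrange_dd:
  "nabla_convex m n I J f \<longleftrightarrow>
    (\<forall>S T. S \<subseteq> I \<and> finite S \<and> card S = Suc m \<and> T \<subseteq> J \<and> finite T \<and> card T = Suc n \<longrightarrow>
      0 \<le> (-1) ^ (m + n) * lagrange_dd S (\<lambda>x. lagrange_dd T (f x)))"
  (is "?L \<longleftrightarrow> ?R")
proof
  assume L: ?L
  show ?R
  proof (intro allI impI, elim conjE)
    fix S T assume *: "S \<subseteq> I" "finite S" "card S = Suc m" "T \<subseteq> J" "finite T" "card T = Suc n"
    obtain u where u: "bij_betw u {0..m} S"
      using ex_bij_betw_nat_finite[OF *(2)] *(3) by (auto simp: atLeastLessThanSuc_atLeastAtMost)
    obtain v where v: "bij_betw v {0..n} T"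
      using ex_bij_betw_nat_finite[OF *(5)] *(6) by (auto simp: atLeastLessThanSuc_atLeastAtMost)
    have uv: "inj_on u {0..m}" "u ` {0..m} = S" "inj_on v {0..n}" "v ` {0..n} = T"
      using u v by (auto simp: bij_betw_def)
    then have "0 \<le> (-1) ^ (m + n) *
        divided_difference u (\<lambda>x. divided_difference v (f x) 0 n) 0 m"
      using L * unfolding nabla_convex_def by blast
    then show "0 \<le> (-1) ^ (m + n) * lagrange_dd S (\<lambda>x. lagrange_dd T (f x))"
      using uv by (simp add: divided_difference_eq_lagrange_dd)
  qed
next
  assume R: ?R
  show ?L
    unfolding nabla_convex_def
  proof (intro allI impI, elim conjE)
    fix u v :: "nat \<Rightarrow> real"
    assume *: "inj_on u {0..m}" "u ` {0..m} \<subseteq> I" "inj_on v {0..n}" "v ` {0..n} \<subseteq> J"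
    have "0 \<le> (-1) ^ (m + n) *
        lagrange_dd (u ` {0..m}) (\<lambda>x. lagrange_dd (v ` {0..n}) (f x))"
      using R * by (simp add: card_image)
    then show "0 \<le> (-1) ^ (m + n) *
        divided_difference u (\<lambda>x. divided_difference v (f x) 0 n) 0 m"
      using * by (simp add: divided_difference_eq_lagrange_dd)
  qed
qed

text \<open>A gap \<open>w\<close> inside \<open>K\<close> is filled by writing the divided difference over \<open>K\<close> as a convex
  combination of those over \<open>K\<close> with the largest, respectively the smallest, node replaced by \<open>w\<close>;
  both have smaller spread.\<close>

lemma lagrange_dd_sign_from_consecutive:
  fixes y :: "nat \<Rightarrow> real"
  assumes mono: "strict_mono_on {1..M} y" and "1 \<le> m"
    and consecutive: "\<And>c. 1 \<le> c \<Longrightarrow> c + m \<le> M \<Longrightarrow> 0 \<le> \<sigma> * lagrange_dd (y ` {c..c + m}) g"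
    and "K \<subseteq> {1..M}" "card K = Suc m"
  shows "0 \<le> \<sigma> * lagrange_dd (y ` K) g"
  using assms(4,5)
proof (induction "Max K - Min K" arbitrary: K rule: less_induct)
  case less
  define a where "a = Min K"
  define b where "b = Max K"
  have fin: "finite K" using less.prems finite_subset by blast
  have ne: "K \<noteq> {}" using less.prems by auto
  have ab: "a \<in> K" "b \<in> K" using fin ne by (auto simp: a_def b_def)
  have bnd: "a \<le> k" "k \<le> b" if "k \<in> K" for k using that fin by (auto simp: a_def b_def)
  show ?case
  proof (cases "K = {a..b}")
    case True
    then have "b = a + m" using less.prems by simp
    then show ?thesis using True consecutive[of a] ab less.prems by auto
  next
    case False
    moreover have "K \<subseteq> {a..b}" using bnd by auto
    ultimately obtain w where "w \<in> {a..b}" and w: "w \<notin> K" by blast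
    moreover have "w \<noteq> a" "w \<noteq> b" using ab w by auto
    ultimately have awb: "a < w" "w < b" by auto
    define T where "T = K - {a, b}"
    have K: "K = insert a (insert b T)" and T: "a \<notin> T" "b \<notin> T" "w \<notin> T" "finite T"
      using ab w awb fin by (auto simp: T_def)
    have cT: "Suc (card T) = m" using less.prems K T awb by simp
    have sub: "insert w K \<subseteq> {1..M}" using less.prems ab awb by fastforce
    have inj: "inj_on y (insert w K)"
      using strict_mono_on_imp_inj_on[OF mono] sub by (rule inj_on_subset)
    have lt: "y a < y w" "y w < y b"
      using strict_mono_onD[OF mono] awb sub ab by auto
    have nT: "y a \<notin> y ` T" "y b \<notin> y ` T" "y w \<notin> y ` T"
      using inj T K awb by (auto dest!: inj_onD)
    \<comment> \<open>The side conditions leave exactly the pairs \<open>(w, b)\<close> and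
      \<open>(a, w)\<close>, so both replacements are treated at once. One extreme index is gone and
      the rest stay between \<open>a\<close> and \<open>b\<close>, so the spread drops.\<close>
    have step: "0 \<le> \<sigma> * lagrange_dd (y ` insert c (insert d T)) g"
      if "c < d" "c \<in> {a, w}" "d \<in> {w, b}" "w \<in> {c, d}" for c d
    proof (rule less.hyps)
      let ?K = "insert c (insert d T)"
      have T': "a < k" "k < b" if "k \<in> T" for k
        using that bnd[of k] T by (auto simp: T_def le_neq_implies_less)
      have fin': "finite ?K" using T by simp
      have lo: "c \<le> Min ?K" if "c = a"
        using T that \<open>c < d\<close> T' by (auto intro: less_imp_le)
      have lo': "a < Min ?K" if "c = w"
        using T that \<open>c < d\<close> T' awb by auto
      have hi: "Max ?K \<le> b" if "d = b"
        using T that \<open>c < d\<close> T' by (auto intro: less_imp_le)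
      have hi': "Max ?K < b" if "d = w"
        using T that \<open>c < d\<close> T' awb by auto
      have "Min ?K \<le> c" "c \<le> Max ?K"
        using fin' by (auto intro: Min_le Max_ge)
      then show "Max ?K - Min ?K < Max K - Min K"
        unfolding a_def[symmetric] b_def[symmetric] using lo lo' hi hi' awb that(1-4) by auto
      show "?K \<subseteq> {1..M}" using sub K that by auto
      show "card ?K = Suc m" using cT T that awb by auto
    qed
    \<comment> \<open>Telescoping: the difference of the values at \<open>insert (y b) (y\<close>
      T)\<open>and\<close>insert (y a) (y \<open>T)\<close> is split at the value for
      \<open>y w\<close>, and each piece is again an instance of the recurrence.\<close>
    have rec: "(y b - y a) * lagrange_dd (y ` K) g =
        (y b - y w) * lagrange_dd (y ` insert w (insert b T)) g +
        (y w - y a) * lagrange_dd (y ` insert a (insert w T)) g"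
      using lagrange_dd_recurrence[of "y ` T" "y b" "y a" g]
        lagrange_dd_recurrence[of "y ` T" "y b" "y w" g]
        lagrange_dd_recurrence[of "y ` T" "y w" "y a" g] nT T lt
      by (simp add: K insert_commute)
    have "(y b - y a) * (\<sigma> * lagrange_dd (y ` K) g) = \<sigma> * ((y b - y a) * lagrange_dd (y ` K) g)"
      by simp
    also have "\<dots> = (y b - y w) * (\<sigma> * lagrange_dd (y ` insert w (insert b T)) g) +
        (y w - y a) * (\<sigma> * lagrange_dd (y ` insert a (insert w T)) g)"
      unfolding rec by (simp add: algebra_simps)
    also have "0 \<le> \<dots>"
      using step[of w b] step[of a w] lt awb
      by (intro add_nonneg_nonneg mult_nonneg_nonneg[of "y b - y w"]
          mult_nonneg_nonneg[of "y w - y a"]) auto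
    finally show ?thesis
      using lt by (simp add: zero_le_mult_iff)
  qed
qed

section \<open>The one-variable basis on the grid\<close>

text \<open>Back substitution: at the last point only the last basis element is nonzero, which
  forces its coefficient; subtracting its multiple leaves a problem on the remaining points.\<close>

lemma triangular_expansion:
  fixes \<phi> :: "nat \<Rightarrow> nat \<Rightarrow> real"
  assumes "\<And>a. a \<in> {1..M} \<Longrightarrow> \<phi> a a \<noteq> 0"
    and "\<And>a s. a \<in> {1..M} \<Longrightarrow> s \<in> {1..M} \<Longrightarrow> a < s \<Longrightarrow> \<phi> a s = 0"
  shows "\<exists>c. \<forall>s\<in>{1..M}. g s = (\<Sum>a=1..M. c a * \<phi> a s)"
  using assms
proof (induction M arbitrary: g)
  case 0
  then show ?case by simp
next
  case (Suc M)
  define d where "d = g (Suc M) / \<phi> (Suc M) (Suc M)"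
  have "\<exists>c. \<forall>s\<in>{1..M}. g s - d * \<phi> (Suc M) s = (\<Sum>a=1..M. c a * \<phi> a s)"
    using Suc.prems by (intro Suc.IH) auto
  then obtain c where c: "\<And>s. s \<in> {1..M} \<Longrightarrow> g s - d * \<phi> (Suc M) s = (\<Sum>a=1..M. c a * \<phi> a s)"
    by blast
  have "g s = (\<Sum>a=1..Suc M. (c(Suc M := d)) a * \<phi> a s)" if s: "s \<in> {1..Suc M}" for s
  proof -
    have eq: "(\<Sum>a=1..Suc M. (c(Suc M := d)) a * \<phi> a s) =
        (\<Sum>a=1..M. c a * \<phi> a s) + d * \<phi> (Suc M) s"
      by simp
    show ?thesis
    proof (cases "s = Suc M")
      case True
      have "(\<Sum>a=1..M. c a * \<phi> a s) = 0"
        using Suc.prems(2) True by (intro sum.neutral) auto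
      then show ?thesis using eq True Suc.prems(1)[of "Suc M"] by (simp add: d_def)
    next
      case False
      then show ?thesis using eq c[of s] s by simp
    qed
  qed
  then show ?case by blast
qed

locale nabla_grid =
  fixes y :: "nat \<Rightarrow> real" and m M :: nat
  assumes m_pos: "1 \<le> m" and m_le: "m \<le> M" and mono: "strict_mono_on {1..M} y"
begin

text \<open>The basis is indexed by the last grid point on which an element does not vanish: the paper's
  \<open>(y\<^sub>M - y\<^sub>s)\<^bsup>{t}\<^esup>\<close> has index \<open>M - t\<close>.\<close>

definition spline :: "nat \<Rightarrow> real \<Rightarrow> real" where
  "spline a x =
    (if a \<le> M - m then (if x \<le> y a then \<Prod>q<m-1. y (a + m - 1 - q) - x else 0)
     else \<Prod>q<M-a. y (M - q) - x)"

text \<open>The form used in the conditions, without the cutoff at \<open>y a\<close>: there the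
  cutoff appears as the upper summation bound \<open>a\<close>.\<close>

definition spline_brace :: "nat \<Rightarrow> nat \<Rightarrow> real" where
  "spline_brace a s =
    (if a \<le> M - m then brace_power y (a + m - 1) s (m - 1) else brace_power y M s (M - a))"

lemma y_less_iff: "i \<in> {1..M} \<Longrightarrow> j \<in> {1..M} \<Longrightarrow> y i < y j \<longleftrightarrow> i < j"
  using strict_mono_on_less[OF mono] by blast

lemma y_le_iff: "i \<in> {1..M} \<Longrightarrow> j \<in> {1..M} \<Longrightarrow> y i \<le> y j \<longleftrightarrow> i \<le> j"
  using y_less_iff[of j i] by (auto simp: not_less[symmetric])

lemma spline_eq_brace:
  assumes "a \<in> {1..M}" "s \<in> {1..a}"
  shows "spline a (y s) = spline_brace a s"
  using assms by (auto simp: spline_def spline_brace_def brace_power_def y_le_iff)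

text \<open>This gives triangularity. In the polynomial case the zeros are precisely the grid points
  after the one with index \<open>a\<close>.\<close>

lemma spline_eq_0:
  assumes "a \<in> {1..M}" "s \<in> {1..M}" "a < s"
  shows "spline a (y s) = 0"
proof (cases "a \<le> M - m")
  case True
  then show ?thesis using assms by (simp add: spline_def y_le_iff)
next
  case False
  have "\<exists>q\<in>{..<M-a}. y (M - q) - y s = 0"
    using assms by (intro bexI[of _ "M - s"]) auto
  then show ?thesis using False by (simp add: spline_def)
qed

lemma spline_diag_pos:
  assumes "a \<in> {1..M}"
  shows "0 < spline a (y a)"
proof (cases "a \<le> M - m")
  case True
  then have "0 < (\<Prod>q<m-1. y (a + m - 1 - q) - y a)"
    using assms m_pos m_le by (intro prod_pos) (auto intro!: strict_mono_onD[OF mono])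
  then show ?thesis using True by (simp add: spline_def)
next
  case False
  have "0 < (\<Prod>q<M-a. y (M - q) - y a)"
    using assms by (intro prod_pos) (auto simp: y_less_iff)
  then show ?thesis using False by (simp add: spline_def)
qed

lemma sum_spline:
  assumes "a \<in> {1..M}"
  shows "(\<Sum>s=1..M. h s * spline a (y s)) = (\<Sum>s=1..a. h s * spline_brace a s)"
proof -
  have "(\<Sum>s=1..M. h s * spline a (y s)) = (\<Sum>s=1..a. h s * spline a (y s))"
    using assms by (intro sum.mono_neutral_right) (auto simp: spline_eq_0)
  then show ?thesis using assms by (simp add: spline_eq_brace)
qed

lemma card_nodes: "K \<subseteq> {1..M} \<Longrightarrow> card (y ` K) = card K"
  using strict_mono_on_imp_inj_on[OF mono] by (intro card_image) (rule inj_on_subset)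

lemma lagrange_dd_spline_poly:
  assumes "a \<in> {1..M}" "M - m < a" "finite S" "card S = Suc m"
  shows "lagrange_dd S (spline a) = 0"
proof -
  have "spline a = (\<lambda>x. \<Prod>q<M-a. y (M - q) - x)"
    using assms by (auto simp: spline_def)
  then show ?thesis
    using assms m_pos m_le lagrange_dd_linear_factors_eq_0[of S "M - a" "\<lambda>q. y (M - q)"] by simp
qed

text \<open>For \<open>c < a\<close> the window ends at index \<open>a + m - 1\<close> at the
  latest, and its nodes beyond \<open>y a\<close> are zeros of the uncut polynomial. So on the
  window the truncated element agrees with a polynomial of degree \<open>m - 1\<close>. For
  \<open>a < c\<close> it vanishes on the whole window.\<close>

lemma lagrange_dd_spline_off_diag:
  assumes "a \<in> {1..M}" "1 \<le> c" "c + m \<le> M" "c \<noteq> a"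
  shows "lagrange_dd (y ` {c..c + m}) (spline a) = 0"
proof -
  have card: "card (y ` {c..c + m}) = Suc m"
    using assms by (subst card_nodes) auto
  consider "M - m < a" | "a \<le> M - m" "c < a" | "a < c"
    using assms by linarith
  then show ?thesis
  proof cases
    case 1
    then show ?thesis using assms card by (simp add: lagrange_dd_spline_poly)
  next
    case 2
    have "spline a x = (\<Prod>q<m-1. y (a + m - 1 - q) - x)" if x: "x \<in> y ` {c..c + m}" for x
    proof -
      obtain s where s: "x = y s" "s \<in> {c..c + m}" using x by blast
      show ?thesis
      proof (cases "s \<le> a")
        case True
        then show ?thesis using 2 s assms by (simp add: spline_def y_le_iff)
      next
        case False
        have "\<exists>q\<in>{..<m-1}. y (a + m - 1 - q) - y s = 0"
          \<comment> \<open>This \<open>q\<close> selects the factor \<open>y s - y s\<close>;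
            \<open>c < a\<close> ensures \<open>s <= a + m - 1\<close>.\<close>
          using False 2 s by (intro bexI[of _ "a + m - 1 - s"]) auto
        then show ?thesis using False s assms by (simp add: spline_eq_0)
      qed
    qed
    then have "lagrange_dd (y ` {c..c + m}) (spline a) =
        lagrange_dd (y ` {c..c + m}) (\<lambda>x. \<Prod>q<m-1. y (a + m - 1 - q) - x)"
      by (rule lagrange_dd_cong)
    also have "\<dots> = 0"
      using card m_pos by (intro lagrange_dd_linear_factors_eq_0) auto
    finally show ?thesis .
  next
    case 3
    have "lagrange_dd (y ` {c..c + m}) (spline a) = lagrange_dd (y ` {c..c + m}) (\<lambda>_. 0)"
      using 3 assms by (intro lagrange_dd_cong) (auto simp: spline_eq_0)
    then show ?thesis by simp
  qed
qed

text \<open>Only the leftmost node contributes, and its denominator is a product of \<open>m\<close>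
  negative differences.\<close>

lemma lagrange_dd_spline_diag:
  assumes "1 \<le> a" "a + m \<le> M"
  shows "0 < (-1) ^ m * lagrange_dd (y ` {a..a + m}) (spline a)"
proof -
  define T where "T = y ` {Suc a..a + m}"
  have img: "y ` {a..a + m} = insert (y a) T"
    using atLeastAtMost_insertL[of a "a + m"] by (auto simp: T_def)
  have T: "finite T" "card T = m"
    unfolding T_def using assms by (auto simp: card_nodes)
  have gt: "y a < t" if "t \<in> T" for t
    using that assms unfolding T_def by (auto simp: y_less_iff)
  then have "y a \<notin> T" by blast
  moreover have "spline a t = 0" if "t \<in> T" for t
    using that assms unfolding T_def by (auto simp: spline_eq_0)
  ultimately have "lagrange_dd (y ` {a..a + m}) (spline a) = spline a (y a) / (\<Prod>t\<in>T. y a - t)"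
    using T by (simp add: img lagrange_dd_insert)
  also have "(\<Prod>t\<in>T. y a - t) = (\<Prod>t\<in>T. (-1) * (t - y a))"
    by (intro prod.cong) auto
  also have "\<dots> = (-1) ^ m * (\<Prod>t\<in>T. t - y a)"
    using T by (simp only: prod.distrib prod_constant)
  finally have "(-1) ^ m * lagrange_dd (y ` {a..a + m}) (spline a) =
      spline a (y a) / (\<Prod>t\<in>T. t - y a)"
    by (cases "even m") auto
  moreover have "0 < (\<Prod>t\<in>T. t - y a)"
    using gt by (intro prod_pos) auto
  ultimately show ?thesis
    using spline_diag_pos[of a] assms by auto
qed

text \<open>It suffices to test consecutive nodes, where the signed difference is positive on the
  diagonal and 0 off it.\<close>

lemma lagrange_dd_spline_nonneg:
  assumes "a \<in> {1..M}" "S \<subseteq> y ` {1..M}" "card S = Suc m"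
  shows "0 \<le> (-1) ^ m * lagrange_dd S (spline a)"
proof -
  obtain K where K: "K \<subseteq> {1..M}" "S = y ` K"
    using assms(2) by (auto simp: subset_image_iff)
  show ?thesis
    unfolding K(2)
  proof (rule lagrange_dd_sign_from_consecutive[OF mono m_pos _ K(1)])
    show "card K = Suc m" using assms(3) K card_nodes by simp
    fix c assume "1 \<le> c" "c + m \<le> M"
    then show "0 \<le> (-1) ^ m * lagrange_dd (y ` {c..c + m}) (spline a)"
      using lagrange_dd_spline_diag[of c] lagrange_dd_spline_off_diag[of a c] assms(1)
      by (cases "c = a") auto
  qed
qed

lemma spline_expansion:
  "\<exists>c. \<forall>s\<in>{1..M}. g s = (\<Sum>a=1..M. c a * spline a (y s))"
proof (rule triangular_expansion[where \<phi> = "\<lambda>a s. spline a (y s)"])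
  show "spline a (y a) \<noteq> 0" if "a \<in> {1..M}" for a
    using spline_diag_pos[OF that] by simp
qed (rule spline_eq_0)

end

section \<open>Tensor products of basis elements and the dual cone\<close>

locale nabla_grid2 = Y: nabla_grid y m M + Z: nabla_grid z n N
  for y :: "nat \<Rightarrow> real" and m M :: nat and z :: "nat \<Rightarrow> real" and n N :: nat
begin

text \<open>A uniform indexing of the left-hand sides of all four families of conditions.\<close>

definition spline_moment :: "(nat \<Rightarrow> nat \<Rightarrow> real) \<Rightarrow> nat \<Rightarrow> nat \<Rightarrow> real" where
  "spline_moment p a b = (\<Sum>s=1..M. \<Sum>r=1..N. p s r * (Y.spline a (y s) * Z.spline b (z r)))"

lemma spline_moment_eq:
  assumes "a \<in> {1..M}" "b \<in> {1..N}"
  shows "spline_moment p a b =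
    (\<Sum>s=1..a. \<Sum>r=1..b. p s r * (Y.spline_brace a s * Z.spline_brace b r))"
proof -
  have "spline_moment p a b =
      (\<Sum>s=1..M. (\<Sum>r=1..N. p s r * Z.spline b (z r)) * Y.spline a (y s))"
    unfolding spline_moment_def sum_distrib_right by (intro sum.cong refl) simp
  also have "\<dots> =
      (\<Sum>s=1..a. \<Sum>r=1..b. p s r * Z.spline_brace b r * Y.spline_brace a s)"
    unfolding Y.sum_spline[OF assms(1)] Z.sum_spline[OF assms(2)] by (simp only: sum_distrib_right)
  finally show ?thesis
    by (simp only: mult.assoc mult.commute[of "Z.spline_brace b r" for r])
qed

text \<open>The mixed difference of a product factors. A polynomial factor makes it 0, whatever the
  sign of \<open>c\<close>; this freedom is the source of the equalities among the
  conditions.\<close>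

lemma nabla_convex_spline_product:
  assumes "a \<in> {1..M}" "b \<in> {1..N}" "0 \<le> c \<or> \<not> (a \<le> M - m \<and> b \<le> N - n)"
  shows "nabla_convex m n (y ` {1..M}) (z ` {1..N}) (\<lambda>x w. c * (Y.spline a x * Z.spline b w))"
  unfolding nabla_convex_iff_lagrange_dd
proof (intro allI impI, elim conjE)
  fix S T assume *: "S \<subseteq> y ` {1..M}" "finite S" "card S = Suc m"
    "T \<subseteq> z ` {1..N}" "finite T" "card T = Suc n"
  have "(-1) ^ (m + n) * lagrange_dd S
        (\<lambda>x. lagrange_dd T (\<lambda>w. c * (Y.spline a x * Z.spline b w))) =
      c * (((-1) ^ m * lagrange_dd S (Y.spline a)) * ((-1) ^ n * lagrange_dd T (Z.spline b)))"
    (is "?l = _")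
    by (simp add: lagrange_dd_cmult lagrange_dd_multc power_add)
  moreover have "0 \<le> \<dots>"
  proof (cases "a \<le> M - m \<and> b \<le> N - n")
    case True
    then show ?thesis
      using assms * Y.lagrange_dd_spline_nonneg Z.lagrange_dd_spline_nonneg by simp
  next
    case False
    then have "lagrange_dd S (Y.spline a) = 0 \<or> lagrange_dd T (Z.spline b) = 0"
      using assms * Y.lagrange_dd_spline_poly Z.lagrange_dd_spline_poly by (meson not_le)
    then show ?thesis by auto
  qed
  ultimately show "0 \<le> ?l" by simp
qed

lemma spline_product_expansion:
  fixes f :: "real \<Rightarrow> real \<Rightarrow> real"
  shows "\<exists>C. \<forall>s\<in>{1..M}. \<forall>r\<in>{1..N}.
    f (y s) (z r) = (\<Sum>a=1..M. \<Sum>b=1..N. C a b * (Y.spline a (y s) * Z.spline b (z r)))"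
proof -
  \<comment> \<open>Expand in the second variable for each fixed \<open>s\<close>; the coefficients
    are then expanded as functions of \<open>s\<close>.\<close>
  have "\<forall>s. \<exists>d. \<forall>r\<in>{1..N}. f (y s) (z r) = (\<Sum>b=1..N. d b * Z.spline b (z r))"
    using Z.spline_expansion[of "\<lambda>r. f (y s) (z r)" for s] by blast
  then obtain D where D: "\<And>s r. r \<in> {1..N} \<Longrightarrow>
      f (y s) (z r) = (\<Sum>b=1..N. D s b * Z.spline b (z r))"
    by metis
  have "\<forall>b. \<exists>c. \<forall>s\<in>{1..M}. D s b = (\<Sum>a=1..M. c a * Y.spline a (y s))"
    using Y.spline_expansion[of "\<lambda>s. D s b" for b] by blast
  then obtain C where C: "\<And>b s. s \<in> {1..M} \<Longrightarrow>
      D s b = (\<Sum>a=1..M. C b a * Y.spline a (y s))"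
    by metis
  have "f (y s) (z r) = (\<Sum>a=1..M. \<Sum>b=1..N. C b a * (Y.spline a (y s) * Z.spline b (z r)))"
    if "s \<in> {1..M}" "r \<in> {1..N}" for s r
  proof -
    have "f (y s) (z r) = (\<Sum>b=1..N. (\<Sum>a=1..M. C b a * Y.spline a (y s)) * Z.spline b (z r))"
      using that by (simp add: D C)
    also have "\<dots> = (\<Sum>b=1..N. \<Sum>a=1..M. C b a * (Y.spline a (y s) * Z.spline b (z r)))"
      by (simp only: sum_distrib_right mult.assoc)
    finally show ?thesis by (subst sum.swap)
  qed
  then show ?thesis by (intro exI[of _ "\<lambda>a b. C b a"]) blast
qed

text \<open>By duality, the mixed difference over the windows starting at \<open>a\<close> and
  \<open>b\<close> isolates \<open>C a b\<close>, up to a factor of known sign.\<close>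

lemma spline_coeff_nonneg:
  assumes conv: "nabla_convex m n (y ` {1..M}) (z ` {1..N}) f"
    and C: "\<And>s r. s \<in> {1..M} \<Longrightarrow> r \<in> {1..N} \<Longrightarrow>
      f (y s) (z r) = (\<Sum>a=1..M. \<Sum>b=1..N. C a b * (Y.spline a (y s) * Z.spline b (z r)))"
    and ab: "1 \<le> a" "a + m \<le> M" "1 \<le> b" "b + n \<le> N"
  shows "0 \<le> C a b"
proof -
  let ?S = "y ` {a..a + m}" and ?T = "z ` {b..b + n}"
  let ?A = "lagrange_dd ?S (Y.spline a)" and ?B = "lagrange_dd ?T (Z.spline b)"
  have sub: "{a..a + m} \<subseteq> {1..M}" "{b..b + n} \<subseteq> {1..N}" using ab by auto
  have "lagrange_dd ?S (\<lambda>x. lagrange_dd ?T (f x)) = lagrange_dd ?S (\<lambda>x. lagrange_dd ?T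
      (\<lambda>w. \<Sum>a'=1..M. \<Sum>b'=1..N. C a' b' * (Y.spline a' x * Z.spline b' w)))"
    using sub by (intro lagrange_dd_cong) (auto simp: C)
  also have "\<dots> = (\<Sum>a'=1..M. \<Sum>b'=1..N.
      C a' b' * (lagrange_dd ?S (Y.spline a') * lagrange_dd ?T (Z.spline b')))"
    by (simp add: lagrange_dd_sum lagrange_dd_cmult lagrange_dd_multc)
  \<comment> \<open>The nested conditionals put the surviving term into the form in which both sums
    collapse.\<close>
  also have "\<dots> = (\<Sum>a'=1..M. \<Sum>b'=1..N. if b' = b then
      if a' = a then C a b * (?A * ?B) else 0 else 0)"
    using ab by (intro sum.cong refl)
      (auto simp: Y.lagrange_dd_spline_off_diag Z.lagrange_dd_spline_off_diag)
  also have "\<dots> = C a b * (?A * ?B)"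
    using ab by simp
  finally have "(-1) ^ (m + n) * lagrange_dd ?S (\<lambda>x. lagrange_dd ?T (f x)) =
      C a b * (((-1) ^ m * ?A) * ((-1) ^ n * ?B))"
    by (simp add: power_add)
  moreover have "0 \<le> (-1) ^ (m + n) * lagrange_dd ?S (\<lambda>x. lagrange_dd ?T (f x))"
    using conv sub unfolding nabla_convex_iff_lagrange_dd
    by (auto simp: Y.card_nodes Z.card_nodes image_mono)
  moreover have "0 < ((-1) ^ m * ?A) * ((-1) ^ n * ?B)"
    using ab by (intro mult_pos_pos Y.lagrange_dd_spline_diag Z.lagrange_dd_spline_diag)
  ultimately show ?thesis
    by (metis zero_le_mult_iff not_le)
qed

lemma nonneg_on_nabla_convex_iff:
  "(\<forall>f. nabla_convex m n (y ` {1..M}) (z ` {1..N}) f \<longrightarrow>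
      0 \<le> (\<Sum>s=1..M. \<Sum>r=1..N. p s r * f (y s) (z r))) \<longleftrightarrow>
    (\<forall>a\<in>{1..M}. \<forall>b\<in>{1..N}.
      if a \<le> M - m \<and> b \<le> N - n then 0 \<le> spline_moment p a b else spline_moment p a b = 0)"
  (is "?L \<longleftrightarrow> ?R")
proof
  assume L: ?L
  show ?R
  proof (intro ballI)
    fix a b assume ab: "a \<in> {1..M}" "b \<in> {1..N}"
    have *: "0 \<le> c * spline_moment p a b" if "0 \<le> c \<or> \<not> (a \<le> M - m \<and> b \<le> N - n)" for c
      using L[rule_format, OF nabla_convex_spline_product[OF ab that]]
      by (simp add: spline_moment_def sum_distrib_left mult_ac)
    \<comment> \<open>Here \<open>c = 1\<close> gives nonnegativity, and \<open>c = - 1\<close>,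
      admissible once a factor is polynomial, gives the opposite inequality.\<close>
    show "if a \<le> M - m \<and> b \<le> N - n then 0 \<le> spline_moment p a b else spline_moment p a b = 0"
      using *[of 1] *[of "- 1"] by auto
  qed
next
  assume R: ?R
  show ?L
  proof (intro allI impI)
    fix f assume conv: "nabla_convex m n (y ` {1..M}) (z ` {1..N}) f"
    obtain C where C: "\<And>s r. s \<in> {1..M} \<Longrightarrow> r \<in> {1..N} \<Longrightarrow>
      f (y s) (z r) = (\<Sum>a=1..M. \<Sum>b=1..N. C a b * (Y.spline a (y s) * Z.spline b (z r)))"
      using spline_product_expansion[of f] by blast
    let ?G = "{1..M} \<times> {1..N}"
    have "(\<Sum>s=1..M. \<Sum>r=1..N. p s r * f (y s) (z r)) = (\<Sum>x\<in>?G. p (fst x) (snd x) *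
        (\<Sum>c\<in>?G. C (fst c) (snd c) * (Y.spline (fst c) (y (fst x)) * Z.spline (snd c) (z (snd x)))))"
      by (simp add: C sum.cartesian_product case_prod_unfold)
    \<comment> \<open>Exchanging the sums turns the functional into a combination of moments with
      the coefficients of \<open>f\<close>.\<close>
    also have "\<dots> = (\<Sum>c\<in>?G. C (fst c) (snd c) * (\<Sum>x\<in>?G. p (fst x) (snd x) *
        (Y.spline (fst c) (y (fst x)) * Z.spline (snd c) (z (snd x)))))"
      unfolding sum_distrib_left by (subst sum.swap) (intro sum.cong refl, simp)
    also have "\<dots> = (\<Sum>(a, b)\<in>?G. C a b * spline_moment p a b)"
      by (simp add: spline_moment_def sum.cartesian_product case_prod_unfold)
    also have "0 \<le> \<dots>"
    proof (rule sum_nonneg, clarify)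
      fix a b assume ab: "a \<in> {1..M}" "b \<in> {1..N}"
      show "0 \<le> C a b * spline_moment p a b"
      proof (cases "a \<le> M - m \<and> b \<le> N - n")
        case True
        then have "0 \<le> C a b"
          using ab Y.m_le Z.m_le by (intro spline_coeff_nonneg[OF conv C]) auto
        then show ?thesis using True R ab by auto
      next
        case False
        then show ?thesis using R ab by auto
      qed
    qed
    finally show "0 \<le> (\<Sum>s=1..M. \<Sum>r=1..N. p s r * f (y s) (z r))" .
  qed
qed

end

section \<open>Translation into the four families of conditions\<close>

text \<open>Separates the polynomial indices, written \<open>M - t\<close> with \<open>t\<close> the
  degree, from those of the truncated elements.\<close>

lemma ball_index_split:
  assumes "1 \<le> m" "m \<le> (M::nat)"
  shows "(\<forall>a\<in>{1..M}. P a) \<longleftrightarrow> (\<forall>t\<in>{0..m-1}. P (M - t)) \<and> (\<forall>t\<in>{1..M-m}. P t)"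
proof -
  have "a \<in> (\<lambda>t. M - t) ` {0..m-1} \<union> {1..M-m}" if "a \<in> {1..M}" for a
  proof (cases "a \<le> M - m")
    case False
    then have "a = M - (M - a)" "M - a \<in> {0..m-1}" using that by auto
    then show ?thesis by blast
  qed (use that in auto)
  then have "{1..M} = (\<lambda>t. M - t) ` {0..m-1} \<union> {1..M-m}"
    using assms by fastforce
  then show ?thesis by (simp only: ball_Un ball_simps)
qed

theorem theorem3p5:
  fixes m n M N :: nat
    and p :: "nat \<Rightarrow> nat \<Rightarrow> real"
    and y z :: "nat \<Rightarrow> real"
    and I\<^sub>1 J\<^sub>1 :: "real set"
  assumes "1 \<le> m" and "1 \<le> n" and "m \<le> M" and "n \<le> N"
    and "strict_mono_on {1..M} y" and "strict_mono_on {1..N} z"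
    and "I\<^sub>1 = y ` {1..M}" and "J\<^sub>1 = z ` {1..N}"
  shows
    "(\<forall>f :: real \<Rightarrow> real \<Rightarrow> real. nabla_convex m n I\<^sub>1 J\<^sub>1 f \<longrightarrow>
        (\<Sum>i=1..M. \<Sum>j=1..N. p i j * f (y i) (z j)) \<ge> 0)
     \<longleftrightarrow>
     (\<forall>k\<in>{0..n-1}. \<forall>t\<in>{0..m-1}.
        (\<Sum>s=1..M-t. \<Sum>r=1..N-k. p s r * brace_power z N r k * brace_power y M s t) = 0) \<and>
     (\<forall>k\<in>{0..n-1}. \<forall>t\<in>{1..M-m}.
        (\<Sum>s=1..t. \<Sum>r=1..N-k.
           p s r * brace_power z N r k * brace_power y (t+m-1) s (m-1)) = 0) \<and>
     (\<forall>k\<in>{1..N-n}. \<forall>t\<in>{0..m-1}.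
        (\<Sum>s=1..M-t. \<Sum>r=1..k.
           p s r * brace_power z (k+n-1) r (n-1) * brace_power y M s t) = 0) \<and>
     (\<forall>k\<in>{1..N-n}. \<forall>t\<in>{1..M-m}.
        (\<Sum>s=1..t. \<Sum>r=1..k.
           p s r * brace_power y (t+m-1) s (m-1) * brace_power z (k+n-1) r (n-1)) \<ge> 0)"
proof -
  interpret nabla_grid2 y m M z n N
    using assms by unfold_locales
  \<comment> \<open>In these names, tail stands for a polynomial index \<open>M - t\<close> or
    \<open>N - k\<close>, head for the index of a truncated element; the first variable comes
    first.\<close>
  have moment_tail_tail: "spline_moment p (M - t) (N - k) =
      (\<Sum>s=1..M-t. \<Sum>r=1..N-k. p s r * brace_power z N r k * brace_power y M s t)"
    and moment_head_tail: "t' \<in> {1..M-m} \<Longrightarrow> spline_moment p t' (N - k) =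
      (\<Sum>s=1..t'. \<Sum>r=1..N-k. p s r * brace_power z N r k * brace_power y (t'+m-1) s (m-1))"
    and moment_tail_head: "k' \<in> {1..N-n} \<Longrightarrow> spline_moment p (M - t) k' =
      (\<Sum>s=1..M-t. \<Sum>r=1..k'. p s r * brace_power z (k'+n-1) r (n-1) * brace_power y M s t)"
    if "k \<in> {0..n-1}" "t \<in> {0..m-1}" for k t k' t'
  proof -
    have le: "M - t \<in> {1..M}" "N - k \<in> {1..N}" "\<not> M - t \<le> M - m" "\<not> N - k \<le> N - n"
      "M - (M - t) = t" "N - (N - k) = k"
      using that assms(1-4) by auto
    show "spline_moment p (M - t) (N - k) =
      (\<Sum>s=1..M-t. \<Sum>r=1..N-k. p s r * brace_power z N r k * brace_power y M s t)"
      by (simp only: spline_moment_eq le Y.spline_brace_def Z.spline_brace_def if_False)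
        (simp add: mult_ac)
    show "spline_moment p t' (N - k) =
      (\<Sum>s=1..t'. \<Sum>r=1..N-k. p s r * brace_power z N r k * brace_power y (t'+m-1) s (m-1))"
      if "t' \<in> {1..M-m}"
    proof -
      have "t' \<in> {1..M}" "t' \<le> M - m" using that by auto
      then show ?thesis
        by (simp only: spline_moment_eq le Y.spline_brace_def Z.spline_brace_def if_True if_False)
          (simp add: mult_ac)
    qed
    show "spline_moment p (M - t) k' =
      (\<Sum>s=1..M-t. \<Sum>r=1..k'. p s r * brace_power z (k'+n-1) r (n-1) * brace_power y M s t)"
      if "k' \<in> {1..N-n}"
    proof -
      have "k' \<in> {1..N}" "k' \<le> N - n" using that by auto
      then show ?thesis
        by (simp only: spline_moment_eq le Y.spline_brace_def Z.spline_brace_def if_True if_False)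
          (simp add: mult_ac)
    qed
  qed
  have moment_head_head: "spline_moment p t k =
      (\<Sum>s=1..t. \<Sum>r=1..k.
        p s r * brace_power y (t+m-1) s (m-1) * brace_power z (k+n-1) r (n-1))"
    if "k \<in> {1..N-n}" "t \<in> {1..M-m}" for k t
  proof -
    have "t \<in> {1..M}" "t \<le> M - m" "k \<in> {1..N}" "k \<le> N - n" using that by auto
    then show ?thesis
      by (simp only: spline_moment_eq Y.spline_brace_def Z.spline_brace_def if_True)
        (simp add: mult_ac)
  qed
  \<comment> \<open>In the mixed identities, 0 instantiates the degree index of the variable whose
    element is truncated.\<close>
  have zero_in: "0 \<in> {0..m-1}" "0 \<in> {0..n-1}" by simp_all
  have tail: "\<not> M - t \<le> M - m" if "t \<in> {0..m-1}" for t
    using that assms(1-4) by auto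
  have tail': "\<not> N - k \<le> N - n" if "k \<in> {0..n-1}" for k
    using that assms(1-4) by auto
  have "(\<forall>a\<in>{1..M}. \<forall>b\<in>{1..N}.
      if a \<le> M - m \<and> b \<le> N - n then 0 \<le> spline_moment p a b else spline_moment p a b = 0) \<longleftrightarrow>
    (\<forall>k\<in>{0..n-1}. \<forall>t\<in>{0..m-1}. spline_moment p (M - t) (N - k) = 0) \<and>
    (\<forall>k\<in>{0..n-1}. \<forall>t\<in>{1..M-m}. spline_moment p t (N - k) = 0) \<and>
    (\<forall>k\<in>{1..N-n}. \<forall>t\<in>{0..m-1}. spline_moment p (M - t) k = 0) \<and>
    (\<forall>k\<in>{1..N-n}. \<forall>t\<in>{1..M-m}. 0 \<le> spline_moment p t k)"
    unfolding ball_index_split[OF assms(1,3)] ball_index_split[OF assms(2,4)]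
    using tail tail' by (auto simp del: diff_le_self)
  then show ?thesis
    unfolding assms(7,8) nonneg_on_nabla_convex_iff
    using moment_tail_tail moment_head_tail[OF _ zero_in(1)]
      moment_tail_head[OF zero_in(2)] moment_head_head
    by simp
qed

end
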